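(* Let $0<\alpha<1$, $l>0$, $T>0$, let $N,M$ be positive integers with $N\geq 2$, let $r\ge 1$, and let $h=l/N$, $x_i=ih$ ($0\le i\le N$), $t_k=T(k/M)^r$ ($0\le k\le M$), $\tau_k=t_k-t_{k-1}$ ($1\le k\le M$). For $1\le j\le k\le M$ put $$d_{k,j}=\frac{(t_k-t_{j-1})^{1-\alpha}-(t_k-t_j)^{1-\alpha}}{\tau_j}.$$ Let $\{u_i^k\}_{0\le i\le N,\,0\le k\le M}$ be the solution of the finite difference scheme $$-\frac{1}{h^2}u_{i+1}^k+\Big(\frac{d_{k,k}}{\Gamma(2-\alpha)}+\frac{2}{h^2}+p^k\Big)u_i^k-\frac{1}{h^2}u_{i-1}^k=\frac{d_{k,1}}{\Gamma(2-\alpha)}u_i^0+\frac{1}{\Gamma(2-\alpha)}\sum_{j=1}^{k-1}\big(d_{k,k-j+1}-d_{k,k-j}\big)u_i^{k-j}+f_i^k$$ for $1\le i\le N-1$, $1\le k\le M$, with Dirichlet conditions $u_0^k=u_N^k=0$ ($0\le k\le M$) and initial data $u_i^0=\varphi(x_i)$ ($0\le i\le N$). Assume $p^k\ge 0$ for all $k$. Then the scheme is unconditionally stable in the maximum norm: for any spatial mesh size $h$ and any such graded time grid, $$\|u^k\|_\infty\le\|\varphi\|_\infty+C_\alpha\max_{1\le m\le k}\|f^m\|_\infty,\qquad 1\le k\le M,$$ where one can choose $$C_\alpha=\frac{\Gamma(2-\alpha)}{\underline{d}_1},\qquad \underline{d}_1:=\min_{1\le m\le M}d_{m,1}.$$ In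 particular, for each $k$, $d_{k,1}=(1-\alpha)\xi^{-\alpha}$ for some $\xi\in(t_k-\tau_1,t_k)\subset(0,T]$, hence $\underline{d}_1\ge(1-\alpha)T^{-\alpha}$ and $$\|u^k\|_\infty\le\|\varphi\|_\infty+T^\alpha\,\Gamma(1-\alpha)\max_{1\le m\le k}\|f^m\|_\infty,\qquad 1\le k\le M,$$ with a constant $T^\alpha\Gamma(1-\alpha)$ independent of $h$, $M$ and $r\ge 1$.
   Context: The scheme is the fully implicit discretisation (nonuniform L1 formula in time, central differences in space) of the problem $\partial_t^\alpha u-u_{xx}+p(t)u=f(x,t)$ on $(0,l)\times[0,T]$ with $u(x,0)=\varphi(x)$ and $u(0,t)=u(l,t)=0$, where $\partial_t^\alpha$ is the Caputo derivative. Here $p^k=p(t_k)$ and $f_i^k=f(x_i,t_k)$ are the nodal values of the given real functions $p$ and $f$, and $\varphi$ is a given real function on $[0,l]$ (with $\varphi(0)=\varphi(l)=0$, by compatibility of the initial and boundary values). Norms are discrete maximum norms over the spatial grid: $\|u^k\|_\infty=\max_{0\le i\le N}|u_i^k|$, $\|f^m\|_\infty=\max_{0\le i\le N}|f_i^m|$, $\|\varphi\|_\infty=\max_{0\le i\le N}|\varphi(x_i)|$. Empty sums are zero. *)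

theory Defs
  imports "HOL-Analysis.Analysis"
begin

definition space_node :: "real \<Rightarrow> nat \<Rightarrow> nat \<Rightarrow> real" where
  "space_node l N i = real i * (l / real N)"

definition time_node :: "real \<Rightarrow> nat \<Rightarrow> real \<Rightarrow> nat \<Rightarrow> real" where
  "time_node T M r k = T * (real k / real M) powr r"

(* Used for k \<ge> 1 only. *)
definition time_step :: "real \<Rightarrow> nat \<Rightarrow> real \<Rightarrow> nat \<Rightarrow> real" where
  "time_step T M r k = time_node T M r k - time_node T M r (k - 1)"

(* Used for 1 \<le> j \<le> k \<le> M only. For j = k the second power is 0 powr (1 - \<alpha>), which is 0. *)
definition L1_coeff :: "real \<Rightarrow> real \<Rightarrow> nat \<Rightarrow> real \<Rightarrow> nat \<Rightarrow> nat \<Rightarrow> real" where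
  "L1_coeff \<alpha> T M r k j =
     ((time_node T M r k - time_node T M r (j - 1)) powr (1 - \<alpha>)
       - (time_node T M r k - time_node T M r j) powr (1 - \<alpha>)) / time_step T M r j"

definition L1_coeff_min :: "real \<Rightarrow> real \<Rightarrow> nat \<Rightarrow> real \<Rightarrow> real" where
  "L1_coeff_min \<alpha> T M r = (MIN m\<in>{1..M}. L1_coeff \<alpha> T M r m 1)"

definition grid_max_norm :: "nat \<Rightarrow> (nat \<Rightarrow> real) \<Rightarrow> real" where
  "grid_max_norm N v = (MAX i\<in>{0..N}. \<bar>v i\<bar>)"

(* Grid functions carry the time index first: u k i is the value at (x_i, t_k).
   Only the values with i \<le> N and k \<le> M are constrained. *)
definition L1_scheme_solution ::
  "real \<Rightarrow> real \<Rightarrow> real \<Rightarrow> nat \<Rightarrow> nat \<Rightarrow> real \<Rightarrow> (real \<Rightarrow> real) \<Rightarrow> (real \<Rightarrow> real \<Rightarrow> real) \<Rightarrow>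
     (real \<Rightarrow> real) \<Rightarrow> (nat \<Rightarrow> nat \<Rightarrow> real) \<Rightarrow> bool" where
  "L1_scheme_solution \<alpha> l T N M r p f \<phi> u \<longleftrightarrow>
     (let h = l / real N; d = L1_coeff \<alpha> T M r; x = space_node l N; t = time_node T M r in
        (\<forall>k\<in>{1..M}. \<forall>i\<in>{1..N - 1}.
           - (1 / h\<^sup>2) * u k (i + 1)
             + (d k k / Gamma (2 - \<alpha>) + 2 / h\<^sup>2 + p (t k)) * u k i
             - (1 / h\<^sup>2) * u k (i - 1)
           = d k 1 / Gamma (2 - \<alpha>) * u 0 i
             + 1 / Gamma (2 - \<alpha>)
                 * (\<Sum>j = 1..k - 1. (d k (k - j + 1) - d k (k - j)) * u (k - j) i)
             + f (x i) (t k)) \<and>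
        (\<forall>k\<in>{0..M}. u k 0 = 0 \<and> u k N = 0) \<and>
        (\<forall>i\<in>{0..N}. u 0 i = \<phi> (x i)))"

end

theory Submission
  imports Defs
begin

text \<open>
  Two facts drive the proof. By the mean value theorem \<open>d k j = (1 - \<alpha>) * \<xi> powr (- \<alpha>)\<close> with \<open>\<xi>\<close> between
  \<open>t k - t j\<close> and \<open>t k - t (j - 1)\<close>, so \<open>d k j\<close> increases with \<open>j\<close>. Hence the right-hand side of
  the scheme is \<open>1 / Gamma (2 - \<alpha>)\<close> times a combination of earlier time levels with nonnegative
  weights of total mass \<open>d k k\<close>, plus \<open>f\<close>. The left-hand operator satisfies a discrete maximum
  principle, which bounds \<open>u k\<close> by the right-hand side divided by \<open>d k k / Gamma (2 - \<alpha>)\<close>. The source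
  is absorbed into the share \<open>d k 1\<close> that the weights give to the initial level, because
  \<open>Gamma (2 - \<alpha>) \<le> d k 1 * C\<close>; strong induction on \<open>k\<close> concludes.
\<close>

lemma grid_max_norm_ge: "i \<le> N \<Longrightarrow> \<bar>v i\<bar> \<le> grid_max_norm N v"
  unfolding grid_max_norm_def by (intro Max_ge) auto

lemma grid_max_norm_nonneg: "0 \<le> grid_max_norm N v"
  using grid_max_norm_ge[of 0 N v] by linarith

lemma grid_max_norm_attained: "\<exists>i\<le>N. grid_max_norm N v = \<bar>v i\<bar>"
proof -
  have "grid_max_norm N v \<in> (\<lambda>i. \<bar>v i\<bar>) ` {0..N}"
    unfolding grid_max_norm_def by (intro Max_in) auto
  then show ?thesis by auto
qed

text \<open>At an index where \<open>\<bar>v i\<bar>\<close> is maximal, each neighbour contributes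
  at most \<open>b * \<bar>v i\<bar>\<close>, so \<open>2 * b\<close> cancels and
  \<open>a * \<bar>v i\<bar> \<le> \<bar>g i\<bar>\<close> remains. The bound does not involve
  \<open>b\<close>, which later is \<open>1 / h\<^sup>2\<close>: this is what makes the stability
  unconditional in the mesh size.\<close>

lemma discrete_maximum_principle:
  fixes v g :: "nat \<Rightarrow> real"
  assumes "0 < a" "0 \<le> b" "0 \<le> B"
    and bdry: "v 0 = 0" "v N = 0"
    and eq: "\<And>i. 1 \<le> i \<Longrightarrow> i < N \<Longrightarrow> (a + 2 * b) * v i = b * v (i + 1) + b * v (i - 1) + g i"
    and g: "\<And>i. 1 \<le> i \<Longrightarrow> i < N \<Longrightarrow> \<bar>g i\<bar> \<le> a * B"
  shows "grid_max_norm N v \<le> B"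
proof -
  obtain i where i: "i \<le> N" "grid_max_norm N v = \<bar>v i\<bar>"
    using grid_max_norm_attained by blast
  show ?thesis
  proof (cases "i = 0 \<or> i = N")
    case True
    then show ?thesis using i bdry \<open>0 \<le> B\<close> by auto
  next
    case False
    then have i': "1 \<le> i" "i < N" using i by auto
    have nb: "b * \<bar>v j\<bar> \<le> b * \<bar>v i\<bar>" if "j \<le> N" for j
      using grid_max_norm_ge[OF that, of v] i(2) \<open>0 \<le> b\<close> by (auto intro: mult_left_mono)
    have "(a + 2 * b) * \<bar>v i\<bar> = \<bar>b * v (i + 1) + b * v (i - 1) + g i\<bar>"
      using eq[OF i'] assms(1,2) by (metis abs_mult abs_of_pos add_pos_nonneg mult_nonneg_nonneg zero_le_numeral)
    also have "\<dots> \<le> b * \<bar>v (i + 1)\<bar> + b * \<bar>v (i - 1)\<bar> + \<bar>g i\<bar>"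
      using abs_mult[of b "v (i + 1)"] abs_mult[of b "v (i - 1)"] \<open>0 \<le> b\<close> by linarith
    also have "\<dots> \<le> b * \<bar>v i\<bar> + b * \<bar>v i\<bar> + a * B"
      using i' by (intro add_mono nb g) auto
    finally have "a * \<bar>v i\<bar> \<le> a * B" by (simp add: algebra_simps)
    then show ?thesis using i \<open>0 < a\<close> by simp
  qed
qed

lemma sum_backward_differences:
  fixes d :: "nat \<Rightarrow> real"
  assumes "1 \<le> k"
  shows "(\<Sum>j = 1..k - 1. d (k - j + 1) - d (k - j)) = d k - d 1"
proof -
  \<comment> \<open>Generalised to partial sums for the induction. The bound \<open>n < k\<close>
    keeps the truncated subtraction exact, so that consecutive terms telescope.\<close>
  have "(\<Sum>j = 1..n. d (k - j + 1) - d (k - j)) = d k - d (k - n)" if "n < k" for n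
    using that
  proof (induction n)
    case (Suc n)
    then have "k - Suc n + 1 = k - n" by simp
    with Suc show ?case by simp
  qed simp
  from this[of "k - 1"] assms show ?thesis by simp
qed

text \<open>The case \<open>a = 0\<close> must be covered, since it arises for the last coefficient
  \<open>d k k\<close>. There the power need not be differentiable at \<open>a\<close>, but the mean
  value theorem asks only for continuity at the endpoints, which \<open>0 < s\<close>
  provides.\<close>

lemma powr_mean_value:
  fixes a b s :: real
  assumes "0 \<le> a" "a < b" "0 < s"
  shows "\<exists>\<xi>\<in>{a<..<b}. (b powr s - a powr s) / (b - a) = s * \<xi> powr (s - 1)"
proof -
  have cont: "continuous_on {a..b} (\<lambda>x. x powr s)"
    using assms by (intro continuous_on_powr') (auto intro: continuous_intros)
  have der: "((\<lambda>x. x powr s) has_derivative (*) (s * x powr (s - 1))) (at x)" if "a < x" "x < b" for x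
    using has_real_derivative_powr[of x s] that assms
    by (auto simp: has_field_derivative_def)
  obtain \<xi> where "a < \<xi>" "\<xi> < b" "b powr s - a powr s = s * \<xi> powr (s - 1) * (b - a)"
    using mvt[OF assms(2) cont der] by (auto simp: mult.commute)
  then show ?thesis using assms(2) by (intro bexI[of _ \<xi>]) (auto simp: field_simps)
qed

lemma time_node_0 [simp]: "time_node T M r 0 = 0"
  by (simp add: time_node_def)

lemma time_node_less:
  assumes "T > 0" "r > 0" "M \<ge> 1" "i < k"
  shows "time_node T M r i < time_node T M r k"
  using assms unfolding time_node_def
  by (intro mult_strict_left_mono powr_less_mono2) (auto simp: divide_strict_right_mono)

lemma time_node_mono:
  assumes "T > 0" "r > 0" "M \<ge> 1" "i \<le> k"
  shows "time_node T M r i \<le> time_node T M r k"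
  using time_node_less[of T r M i k] assms by (cases "i = k") auto

lemma time_node_le:
  assumes "T > 0" "r > 0" "M \<ge> 1" "k \<le> M"
  shows "time_node T M r k \<le> T"
  using time_node_mono[OF assms] assms by (simp add: time_node_def)

text \<open>The step \<tau>_j equals (t_k - t_{j-1}) - (t_k - t_j), so the coefficient is a
  difference quotient of \<open>x powr (1 - \<alpha>)\<close>.\<close>

lemma L1_coeff_mean_value:
  assumes "\<alpha> < 1" "T > 0" "r > 0" "M \<ge> 1" "1 \<le> j" "j \<le> k"
  shows "\<exists>\<xi>\<in>{time_node T M r k - time_node T M r j <..< time_node T M r k - time_node T M r (j - 1)}.
           L1_coeff \<alpha> T M r k j = (1 - \<alpha>) * \<xi> powr (- \<alpha>)"
  using powr_mean_value[of "time_node T M r k - time_node T M r j"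
      "time_node T M r k - time_node T M r (j - 1)" "1 - \<alpha>"]
    time_node_mono[of T r M j k] time_node_less[of T r M "j - 1" j] assms
  by (simp add: L1_coeff_def time_step_def)

text \<open>The mean value points for \<open>j\<close> and \<open>Suc j\<close> lie in adjacent
  intervals, on either side of t_k - t_j, and \<open>x powr (- \<alpha>)\<close> is decreasing for
  positive \<open>x\<close>. This is the source of the nonnegative weights in the history
  sum.\<close>

lemma L1_coeff_le_Suc:
  assumes "0 < \<alpha>" "\<alpha> < 1" "T > 0" "r > 0" "M \<ge> 1" "1 \<le> j" "Suc j \<le> k"
  shows "L1_coeff \<alpha> T M r k j \<le> L1_coeff \<alpha> T M r k (Suc j)"
proof -
  let ?t = "time_node T M r"
  obtain \<xi> where \<xi>: "?t k - ?t j < \<xi>" "L1_coeff \<alpha> T M r k j = (1 - \<alpha>) * \<xi> powr (- \<alpha>)"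
    using L1_coeff_mean_value[of \<alpha> T r M j k] assms by auto
  obtain \<eta> where \<eta>: "?t k - ?t (Suc j) < \<eta>" "\<eta> < ?t k - ?t j"
    "L1_coeff \<alpha> T M r k (Suc j) = (1 - \<alpha>) * \<eta> powr (- \<alpha>)"
    using L1_coeff_mean_value[of \<alpha> T r M "Suc j" k] assms by auto
  have "0 < \<eta>" using \<eta>(1) time_node_mono[of T r M "Suc j" k] assms by simp
  then have "\<xi> powr (- \<alpha>) \<le> \<eta> powr (- \<alpha>)"
    using \<xi>(1) \<eta>(2) assms by (intro powr_mono2') auto
  then show ?thesis using \<xi> \<eta> assms by simp
qed

lemma L1_coeff_first_mean_value:
  assumes "\<alpha> < 1" "T > 0" "r > 0" "M \<ge> 1" "1 \<le> k"
  shows "\<exists>\<xi>\<in>{time_node T M r k - time_step T M r 1 <..< time_node T M r k}.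
           L1_coeff \<alpha> T M r k 1 = (1 - \<alpha>) * \<xi> powr (- \<alpha>)"
  using L1_coeff_mean_value[of \<alpha> T r M 1 k] assms by (simp add: time_step_def)

text \<open>As t_0 = 0, the first step is t_1 itself, so the left endpoint t_k - t_1 is nonnegative;
  it is 0 for \<open>k = 1\<close>.\<close>

lemma first_mean_value_interval_subset:
  assumes "T > 0" "r > 0" "M \<ge> 1" "1 \<le> k" "k \<le> M"
  shows "{time_node T M r k - time_step T M r 1 <..< time_node T M r k} \<subseteq> {0<..T}"
  using time_node_le[of T r M k] time_node_mono[of T r M 1 k] assms
  by (auto simp: time_step_def)

lemma L1_coeff_first_ge:
  assumes "0 < \<alpha>" "\<alpha> < 1" "T > 0" "r > 0" "M \<ge> 1" "1 \<le> k" "k \<le> M"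
  shows "(1 - \<alpha>) * T powr (- \<alpha>) \<le> L1_coeff \<alpha> T M r k 1"
proof -
  obtain \<xi> where "0 < \<xi>" "\<xi> \<le> T" "L1_coeff \<alpha> T M r k 1 = (1 - \<alpha>) * \<xi> powr (- \<alpha>)"
    using L1_coeff_first_mean_value[of \<alpha> T r M k] first_mean_value_interval_subset[of T r M k] assms
    by (auto simp: subset_iff)
  then show ?thesis
    using assms by (auto intro!: mult_left_mono powr_mono2')
qed

lemma L1_coeff_min_ge:
  assumes "0 < \<alpha>" "\<alpha> < 1" "T > 0" "r > 0" "M \<ge> 1"
  shows "(1 - \<alpha>) * T powr (- \<alpha>) \<le> L1_coeff_min \<alpha> T M r"
  unfolding L1_coeff_min_def using L1_coeff_first_ge[of \<alpha> T r M] assms by simp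

lemma L1_coeff_min_le: "1 \<le> k \<Longrightarrow> k \<le> M \<Longrightarrow> L1_coeff_min \<alpha> T M r \<le> L1_coeff \<alpha> T M r k 1"
  unfolding L1_coeff_min_def by (intro Min_le) auto

text \<open>One time step at a fixed space index. The initial value is bounded by \<open>A\<close>
  alone, while the other levels only satisfy the weaker bound \<open>A + C * F\<close>. The weight
  \<open>d 1\<close> therefore leaves a surplus \<open>d 1 * C * F\<close>, which pays for the
  source term \<open>G * F\<close>.\<close>

lemma L1_step_bound:
  fixes w :: "nat \<Rightarrow> real" and d :: "nat \<Rightarrow> real"
  assumes "1 \<le> k" "0 < G" "0 < d 1"
    and mono: "\<And>j. 1 \<le> j \<Longrightarrow> j < k \<Longrightarrow> d j \<le> d (Suc j)"
    and w: "\<And>j. 1 \<le> j \<Longrightarrow> j < k \<Longrightarrow> \<bar>w j\<bar> \<le> A + C * F"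
    and "\<bar>w 0\<bar> \<le> A" "\<bar>s\<bar> \<le> F" "G \<le> d 1 * C"
  shows "\<bar>d 1 / G * w 0 + 1 / G * (\<Sum>j = 1..k - 1. (d (k - j + 1) - d (k - j)) * w (k - j)) + s\<bar>
           \<le> d k / G * (A + C * F)"
proof -
  let ?B = "A + C * F"
  let ?S = "\<Sum>j = 1..k - 1. (d (k - j + 1) - d (k - j)) * w (k - j)"
  have "\<bar>?S\<bar> \<le> (\<Sum>j = 1..k - 1. (d (k - j + 1) - d (k - j)) * ?B)"
  proof (rule sum_abs[THEN order_trans], rule sum_mono)
    fix j assume "j \<in> {1..k - 1}"
    then have j: "1 \<le> k - j" "k - j < k" by auto
    show "\<bar>(d (k - j + 1) - d (k - j)) * w (k - j)\<bar> \<le> (d (k - j + 1) - d (k - j)) * ?B"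
      using mono[OF j] w[OF j] by (simp add: abs_mult mult_left_mono)
  qed
  also have "\<dots> = (d k - d 1) * ?B"
    using sum_backward_differences[OF \<open>1 \<le> k\<close>, of d] by (simp flip: sum_distrib_right)
  finally have S: "\<bar>?S\<bar> \<le> (d k - d 1) * ?B" .
  have "0 \<le> F" using \<open>\<bar>s\<bar> \<le> F\<close> by linarith
  then have GF: "G * F \<le> d 1 * C * F" using \<open>G \<le> d 1 * C\<close> by (rule mult_right_mono[rotated])
  \<comment> \<open>Multiplication by \<open>G\<close> clears the denominators.\<close>
  have "G * \<bar>d 1 / G * w 0 + 1 / G * ?S + s\<bar> = \<bar>d 1 * w 0 + ?S + G * s\<bar>"
    using \<open>0 < G\<close> abs_mult[of G "d 1 / G * w 0 + 1 / G * ?S + s"] by (simp add: distrib_left)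
  also have "\<dots> \<le> d 1 * \<bar>w 0\<bar> + \<bar>?S\<bar> + G * \<bar>s\<bar>"
    using abs_mult[of G s] abs_mult[of "d 1" "w 0"] \<open>0 < G\<close> \<open>0 < d 1\<close> by simp linarith
  also have "\<dots> \<le> d 1 * A + (d k - d 1) * ?B + G * F"
    using S \<open>\<bar>w 0\<bar> \<le> A\<close> \<open>\<bar>s\<bar> \<le> F\<close> \<open>0 < G\<close> \<open>0 < d 1\<close> by (intro add_mono mult_left_mono) auto
  \<comment> \<open>The left side is \<open>d k * ?B - d 1 * C * F + G * F\<close>, and
    \<open>GF\<close> makes the last two terms nonpositive together.\<close>
  also have "\<dots> \<le> d k * ?B" using GF by (simp add: algebra_simps)
  finally show ?thesis using \<open>0 < G\<close> by (simp add: field_simps)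
qed

text \<open>The induction is strong because the discrete memory term involves all earlier levels.
  The same constant serves at every level, so nothing accumulates with the number of steps.\<close>

lemma L1_scheme_stability:
  assumes par: "0 < \<alpha>" "\<alpha> < 1" "T > 0" "r > 0" "M \<ge> 1"
    and sol: "L1_scheme_solution \<alpha> l T N M r p f \<phi> u"
    and p: "\<forall>k\<in>{1..M}. p (time_node T M r k) \<ge> 0"
    and k: "1 \<le> k" "k \<le> M"
  shows "grid_max_norm N (u k) \<le> grid_max_norm N (\<lambda>i. \<phi> (space_node l N i))
           + Gamma (2 - \<alpha>) / L1_coeff_min \<alpha> T M r
               * (MAX m\<in>{1..k}. grid_max_norm N (\<lambda>i. f (space_node l N i) (time_node T M r m)))"
  using k
proof (induction k rule: less_induct)
  case (less k)
  let ?d = "L1_coeff \<alpha> T M r" and ?t = "time_node T M r" and ?x = "space_node l N"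
  let ?G = "Gamma (2 - \<alpha>)" and ?h = "l / real N"
  let ?F = "\<lambda>m. grid_max_norm N (\<lambda>i. f (?x i) (?t m))"
  let ?C = "?G / L1_coeff_min \<alpha> T M r" and ?A = "grid_max_norm N (\<lambda>i. \<phi> (?x i))"
  let ?Fk = "MAX m\<in>{1..k}. ?F m"
  have G: "0 < ?G" using par by (intro Gamma_real_pos) auto
  have "0 < (1 - \<alpha>) * T powr (- \<alpha>)" using par by simp
  then have dmin: "0 < L1_coeff_min \<alpha> T M r" using L1_coeff_min_ge[OF par] by linarith
  have d1: "L1_coeff_min \<alpha> T M r \<le> ?d k 1" using L1_coeff_min_le less.prems by blast
  \<comment> \<open>\<open>?G\<close> equals the minimal first coefficient times \<open>?C\<close>;
    taking the minimum over all levels makes the inequality available for each \<open>k\<close> with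
    one constant.\<close>
  have C: "0 \<le> ?C" "?G \<le> ?d k 1 * ?C" using G dmin d1 by (auto simp: field_simps)
  have FF: "?F m \<le> ?Fk" if "1 \<le> m" "m \<le> k" for m
    using that by (intro Max_ge) auto
  have Fk0: "0 \<le> ?Fk"
    using less.prems by (intro order_trans[OF grid_max_norm_nonneg FF[of 1]]) auto
  have mono: "?d k j \<le> ?d k (Suc j)" if "1 \<le> j" "j < k" for j
    using L1_coeff_le_Suc[OF par] that by simp
  \<comment> \<open>Monotonicity passes positivity on from the first coefficient to the diagonal
    one, \<open>?d k k\<close>.\<close>
  have "?d k 1 \<le> ?d k j" if "1 \<le> j" "j \<le> k" for j
    using that
  proof (induction j rule: dec_induct)
    case (step j)
    then show ?case using mono[of j] by simp
  qed simp
  then have dk: "?d k 1 \<le> ?d k k" using less.prems by simp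
  have prev: "\<bar>u j i\<bar> \<le> ?A + ?C * ?Fk" if "1 \<le> j" "j < k" "i \<le> N" for i j
  proof -
    \<comment> \<open>The induction hypothesis at level \<open>j\<close> sees the sources up to
      \<open>j\<close> only; its maximum is enlarged to the range up to \<open>k\<close>.\<close>
    have "(MAX m\<in>{1..j}. ?F m) \<le> ?Fk" using that by (intro Max_mono) auto
    then have "?C * (MAX m\<in>{1..j}. ?F m) \<le> ?C * ?Fk" using C(1) by (rule mult_left_mono)
    then show ?thesis
      using less.IH[of j] less.prems that grid_max_norm_ge[of i N "u j"] by linarith
  qed
  have scheme: "- (1 / ?h\<^sup>2) * u k (i + 1) + (?d k k / ?G + 2 / ?h\<^sup>2 + p (?t k)) * u k i
        - (1 / ?h\<^sup>2) * u k (i - 1)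
      = ?d k 1 / ?G * u 0 i
        + 1 / ?G * (\<Sum>j = 1..k - 1. (?d k (k - j + 1) - ?d k (k - j)) * u (k - j) i) + f (?x i) (?t k)"
    if "1 \<le> i" "i < N" for i
    using sol less.prems that unfolding L1_scheme_solution_def Let_def by auto
  have init: "u 0 i = \<phi> (?x i)" if "i \<le> N" for i
    using sol that unfolding L1_scheme_solution_def Let_def by auto
  let ?g = "\<lambda>i. ?d k 1 / ?G * u 0 i
        + 1 / ?G * (\<Sum>j = 1..k - 1. (?d k (k - j + 1) - ?d k (k - j)) * u (k - j) i) + f (?x i) (?t k)"
  have pk: "0 \<le> p (?t k)" using p less.prems by auto
  have B: "0 \<le> ?A + ?C * ?Fk"
    using C(1) Fk0 grid_max_norm_nonneg by (intro add_nonneg_nonneg mult_nonneg_nonneg)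
  show ?case
  \<comment> \<open>The reaction term \<open>p\<close> joins the time coefficient in
    \<open>a\<close>; the second difference supplies \<open>b\<close>.\<close>
  proof (rule discrete_maximum_principle[where a = "?d k k / ?G + p (?t k)" and b = "1 / ?h\<^sup>2" and g = ?g])
    show "0 < ?d k k / ?G + p (?t k)"
      using G dmin d1 dk pk by (intro add_pos_nonneg divide_pos_pos) auto
    show "u k 0 = 0" "u k N = 0"
      using sol less.prems unfolding L1_scheme_solution_def Let_def by auto
    show "(?d k k / ?G + p (?t k) + 2 * (1 / ?h\<^sup>2)) * u k i = 1 / ?h\<^sup>2 * u k (i + 1) + 1 / ?h\<^sup>2 * u k (i - 1) + ?g i"
      if "1 \<le> i" "i < N" for i
      using scheme[OF that] by (simp add: algebra_simps)
    show "\<bar>?g i\<bar> \<le> (?d k k / ?G + p (?t k)) * (?A + ?C * ?Fk)" if i: "1 \<le> i" "i < N" for i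
    proof -
      have "\<bar>?g i\<bar> \<le> ?d k k / ?G * (?A + ?C * ?Fk)"
      proof (rule L1_step_bound[where w = "\<lambda>j. u j i" and d = "?d k"])
        show "\<bar>u 0 i\<bar> \<le> ?A"
          using grid_max_norm_ge[of i N "\<lambda>i. \<phi> (?x i)"] init i by simp
        show "\<bar>f (?x i) (?t k)\<bar> \<le> ?Fk"
          by (rule order_trans[OF grid_max_norm_ge[of i N "\<lambda>i. f (?x i) (?t k)"] FF[of k]])
            (use less.prems i in auto)
      qed (use less.prems G dmin d1 C mono prev i in auto)
      \<comment> \<open>Nonnegative \<open>p\<close> only enlarges the diagonal, so the bound with
        \<open>?d k k / ?G\<close> alone is enough.\<close>
      also have "\<dots> \<le> (?d k k / ?G + p (?t k)) * (?A + ?C * ?Fk)"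
        using B pk by (intro mult_right_mono) auto
      finally show ?thesis .
    qed
  qed (use B in auto)
qed

theorem theorem4p1:
  fixes \<alpha> l T r :: real and N M :: nat
    and p \<phi> :: "real \<Rightarrow> real" and f :: "real \<Rightarrow> real \<Rightarrow> real"
    and u :: "nat \<Rightarrow> nat \<Rightarrow> real"
  assumes "0 < \<alpha>" and "\<alpha> < 1" and "l > 0" and "T > 0"
    and "N \<ge> 2" and "M \<ge> 1" and "r \<ge> 1"
    and "\<phi> 0 = 0" and "\<phi> l = 0"
    and "L1_scheme_solution \<alpha> l T N M r p f \<phi> u"
    and "\<forall>k\<in>{1..M}. p (time_node T M r k) \<ge> 0"
  shows
    "(\<forall>k\<in>{1..M}.
        grid_max_norm N (u k)
          \<le> grid_max_norm N (\<lambda>i. \<phi> (space_node l N i))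
            + Gamma (2 - \<alpha>) / L1_coeff_min \<alpha> T M r
              * (MAX m\<in>{1..k}. grid_max_norm N (\<lambda>i. f (space_node l N i) (time_node T M r m)))) \<and>
     (\<forall>k\<in>{1..M}.
        {time_node T M r k - time_step T M r 1 <..< time_node T M r k} \<subseteq> {0<..T} \<and>
        (\<exists>\<xi>\<in>{time_node T M r k - time_step T M r 1 <..< time_node T M r k}.
           L1_coeff \<alpha> T M r k 1 = (1 - \<alpha>) * \<xi> powr (- \<alpha>))) \<and>
     L1_coeff_min \<alpha> T M r \<ge> (1 - \<alpha>) * T powr (- \<alpha>) \<and>
     (\<forall>k\<in>{1..M}.
        grid_max_norm N (u k)
          \<le> grid_max_norm N (\<lambda>i. \<phi> (space_node l N i))
            + T powr \<alpha> * Gamma (1 - \<alpha>)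
              * (MAX m\<in>{1..k}. grid_max_norm N (\<lambda>i. f (space_node l N i) (time_node T M r m))))"
proof -
  have par: "0 < \<alpha>" "\<alpha> < 1" "T > 0" "r > 0" "M \<ge> 1" using assms by auto
  \<comment> \<open>The factor \<open>1 - \<alpha>\<close> from the functional equation cancels the
    one in the lower bound for the coefficients, turning \<open>Gamma (2 - \<alpha>)\<close> into
    \<open>Gamma (1 - \<alpha>)\<close>.\<close>
  have G: "Gamma (2 - \<alpha>) = (1 - \<alpha>) * Gamma (1 - \<alpha>)"
    using Gamma_plus1[of "1 - \<alpha>"] nonpos_Ints_nonpos[of "1 - \<alpha>"] par by (auto simp: algebra_simps)
  have G1: "0 < Gamma (1 - \<alpha>)" using par by (intro Gamma_real_pos) auto
  have low: "0 < (1 - \<alpha>) * T powr (- \<alpha>)" using par by simp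
  have "Gamma (2 - \<alpha>) / L1_coeff_min \<alpha> T M r \<le> Gamma (2 - \<alpha>) / ((1 - \<alpha>) * T powr (- \<alpha>))"
    using L1_coeff_min_ge[OF par] low less_le_trans[OF low] G G1 par
    by (intro divide_left_mono mult_pos_pos) auto
  also have "\<dots> = T powr \<alpha> * Gamma (1 - \<alpha>)"
    using par by (simp add: G powr_minus field_simps)
  finally have C: "Gamma (2 - \<alpha>) / L1_coeff_min \<alpha> T M r \<le> T powr \<alpha> * Gamma (1 - \<alpha>)" .
  let ?F = "\<lambda>m. grid_max_norm N (\<lambda>i. f (space_node l N i) (time_node T M r m))"
  have stab: "grid_max_norm N (u k) \<le> grid_max_norm N (\<lambda>i. \<phi> (space_node l N i))
      + Gamma (2 - \<alpha>) / L1_coeff_min \<alpha> T M r * (MAX m\<in>{1..k}. ?F m)" if "k \<in> {1..M}" for k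
    using L1_scheme_stability[OF par assms(10,11)] that by simp
  have "grid_max_norm N (u k) \<le> grid_max_norm N (\<lambda>i. \<phi> (space_node l N i))
      + T powr \<alpha> * Gamma (1 - \<alpha>) * (MAX m\<in>{1..k}. ?F m)" if k: "k \<in> {1..M}" for k
  proof -
    have "?F k \<le> (MAX m\<in>{1..k}. ?F m)" using k by (intro Max_ge) auto
    \<comment> \<open>Replacing the constant by a larger one requires its factor to be
      nonnegative.\<close>
    then have "0 \<le> (MAX m\<in>{1..k}. ?F m)" using grid_max_norm_nonneg order_trans by blast
    from mult_right_mono[OF C this] stab[OF k] show ?thesis by linarith
  qed
  with stab show ?thesis
    using first_mean_value_interval_subset[OF par(3-5)] L1_coeff_first_mean_value[OF par(2-5)]
      L1_coeff_min_ge[OF par] by simp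
qed

end
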